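(* Let vectors $v^1, \ldots, v^n \in \mathbb{R}^n$ form an orthonormal basis, let $c_0, c_1, d_0, d_1 \in \mathbb{R}^n$ be vectors, let $\alpha_1, \ldots, \alpha_n, r_0, r_1, R_0, R_1 > 0$ and $\lambda \in [0,1]$ be reals, and let $$E = \left\{ x \in \mathbb{R}^n : \sum_{i=1}^n \frac{\langle x, v^i \rangle^2}{\alpha_i^2} \leq 1 \right\}.$$ For $i = 1, \ldots, n$, let $\mu_i \in [0,1]$ with $$1 - (1-\lambda) \left( \tfrac{R_1}{R_0} \alpha_i \right)^{\lambda} \leq \mu_i \leq \lambda \left( \tfrac{R_1}{R_0} \alpha_i \right)^{\lambda - 1}.$$ If $K, L \subseteq \mathbb{R}^n$ are convex bodies such that $$(r_0 E_0 + c_0) \cup (r_1 E_1 + c_1) \subseteq K \quad \text{and} \quad L \subseteq (R_0 E_0 + d_0) \cap (R_1 E_1 + d_1),$$ then $$r_\lambda E_\lambda + c_\lambda \subseteq K \quad \text{and} \quad L \subseteq R_\lambda E_\lambda + d_\lambda,$$ where $c_\lambda = (1-\lambda) c_0 + \lambda c_1$, $d_\lambda = \sum_{i=1}^n \left( (1-\mu_i) \langle d_0, v^i \rangle + \mu_i \langle d_1, v^i \rangle \right) v^i$, $r_\lambda = r_0^{1-\lambda} r_1^\lambda$, and $R_\lambda = R_0^{1-\lambda} R_1^\lambda$. If $\lambda \in (0,1)$, then additionally: (i) any common boundary point of $r_\lambda E_\lambda + c_\lambda$ and $K$ is contained in the affine subspace $\left( \operatorname{lin} \{ v^i : \alpha_i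 = \frac{r_0}{r_1}, \ i = 1, \ldots, n \} \cap (\operatorname{lin} \{ c_0 - c_1 \})^\perp \right) + c_\lambda$, and (ii) any common boundary point of $R_\lambda E_\lambda + d_\lambda$ and $L$ is contained in the affine subspace $\operatorname{lin} \{ v^i : \alpha_i = \frac{R_0}{R_1}, \ i = 1, \ldots, n \} + d_\lambda$ and is a boundary point of $R_0 E_0 + d_0$ and $R_1 E_1 + d_1$, as well. If any such point exists, then $d_0 = d_1$.
   Context: A convex body in $\mathbb{R}^n$ is a compact convex set with non-empty interior. $\langle \cdot, \cdot \rangle$ is the standard inner product, $\operatorname{lin}$ denotes linear span, and $\perp$ denotes orthogonal complement. For the given orthonormal basis $v^1, \ldots, v^n$ and $\alpha_1, \ldots, \alpha_n > 0$, the mean ellipsoid of the Euclidean unit ball $\mathbb{B}^n$ and $E$ for weight $\lambda \in [0,1]$ is $$E_\lambda = \left\{ x \in \mathbb{R}^n : \sum_{i=1}^n \frac{\langle x, v^i \rangle^2}{\alpha_i^{2\lambda}} \leq 1 \right\}.$$ In particular $E_0 = \mathbb{B}^n$ and $E_1 = E$. *)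

theory Defs
  imports "HOL-Analysis.Analysis"
begin

definition convex_body :: "'a::euclidean_space set \<Rightarrow> bool" where
  "convex_body K \<longleftrightarrow> compact K \<and> convex K \<and> interior K \<noteq> {}"

definition orthonormal_basis :: "('n::finite \<Rightarrow> real ^ 'n) \<Rightarrow> bool" where
  "orthonormal_basis v \<longleftrightarrow>
     (\<forall>i j. v i \<bullet> v j = (if i = j then 1 else 0)) \<and> span (range v) = UNIV"

definition ellipsoid :: "('n::finite \<Rightarrow> real ^ 'n) \<Rightarrow> ('n \<Rightarrow> real) \<Rightarrow> (real ^ 'n) set" where
  "ellipsoid v \<alpha> = {x. (\<Sum>i\<in>UNIV. (x \<bullet> v i)\<^sup>2 / (\<alpha> i)\<^sup>2) \<le> 1}"

text \<open>
  The mean ellipsoid of the Euclidean unit ball and \<open>ellipsoid v \<alpha>\<close> for weight \<open>l\<close>.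
  The exponent \<open>2 * l\<close> is real, hence \<open>powr\<close>, which is the usual power here because
  \<open>\<alpha> i > 0\<close> is always assumed.
\<close>

definition mean_ellipsoid ::
    "('n::finite \<Rightarrow> real ^ 'n) \<Rightarrow> ('n \<Rightarrow> real) \<Rightarrow> real \<Rightarrow> (real ^ 'n) set" where
  "mean_ellipsoid v \<alpha> l = {x. (\<Sum>i\<in>UNIV. (x \<bullet> v i)\<^sup>2 / \<alpha> i powr (2 * l)) \<le> 1}"

lemma mean_ellipsoid_1:
  assumes "\<And>i. \<alpha> i > 0"
  shows "mean_ellipsoid v \<alpha> 1 = ellipsoid v \<alpha>"
proof -
  have "\<alpha> i powr 2 = (\<alpha> i)\<^sup>2" for i
    using assms[of i] powr_realpow[of "\<alpha> i" 2] by simp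
  then show ?thesis
    by (simp add: mean_ellipsoid_def ellipsoid_def)
qed

lemma orthonormal_basis_expansion:
  assumes "orthonormal_basis v"
  shows "(\<Sum>i\<in>UNIV. (x \<bullet> v i) *\<^sub>R v i) = x"
proof -
  have v: "v i \<bullet> v j = (if i = j then 1 else 0)" for i j
    using assms by (simp add: orthonormal_basis_def)
  let ?P = "\<lambda>x. (\<Sum>i\<in>UNIV. (x \<bullet> v i) *\<^sub>R v i) = x"
  have "x \<in> span (range v)"
    using assms by (simp add: orthonormal_basis_def)
  then show "?P x"
  proof (induction rule: span_induct_alt)
    case base
    show ?case by simp
  next
    case (step c x y)
    then obtain j where x: "x = v j" by auto
    have "(\<Sum>i\<in>UNIV. (v j \<bullet> v i) *\<^sub>R v i) = v j"
      by (simp add: v if_distrib[of "\<lambda>c. c *\<^sub>R _"] cong: if_cong)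
    then have "(\<Sum>i\<in>UNIV. ((c *\<^sub>R x) \<bullet> v i) *\<^sub>R v i) = c *\<^sub>R x"
      by (simp add: x flip: scaleR_scaleR scaleR_sum_right)
    with step show ?case
      by (simp add: inner_add_left scaleR_add_left sum.distrib)
  qed
qed

lemma mean_ellipsoid_0:
  assumes v: "orthonormal_basis v" and \<alpha>: "\<And>i. \<alpha> i > 0"
  shows "mean_ellipsoid v \<alpha> 0 = cball 0 1"
proof -
  have eq: "(\<Sum>i\<in>UNIV. (x \<bullet> v i)\<^sup>2) = (norm x)\<^sup>2" for x
  proof -
    have "(norm x)\<^sup>2 = x \<bullet> (\<Sum>i\<in>UNIV. (x \<bullet> v i) *\<^sub>R v i)"
      by (simp add: orthonormal_basis_expansion[OF v] power2_norm_eq_inner)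
    also have "\<dots> = (\<Sum>i\<in>UNIV. (x \<bullet> v i)\<^sup>2)"
      by (simp add: inner_sum_right power2_eq_square)
    finally show ?thesis by simp
  qed
  have nz: "\<alpha> i \<noteq> 0" for i
    using \<alpha>[of i] by simp
  show ?thesis
    by (auto simp: mean_ellipsoid_def eq nz power_le_one_iff)
qed

end

theory Submission
  imports Defs
begin

text \<open>
  Everything is decided coordinate by coordinate in the basis \<open>v\<close>, where all the ellipsoids
  are diagonal.

  Inner inclusion: along \<open>v i\<close> the mean ellipsoid has semi-axis
  \<open>r0 powr (1 - l) * (r1 * \<alpha> i) powr l\<close>, the weighted geometric mean of the semi-axes of the two
  given ellipsoids. It is at most their arithmetic mean, so each coordinate can be scaled down
  and every point of the mean ellipsoid becomes a convex combination, with weights \<open>1 - l\<close> and \<open>l\<close>,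
  of one point in each given ellipsoid (\<open>inner_ellipsoid_decomposition\<close>). Convexity of \<open>K\<close> does
  the rest. If such a combination lies on the boundary of \<open>K\<close>, then its two constituents
  cannot be interior to \<open>K\<close>; this leaves no room in the inequality between the means, and only
  coordinates with \<open>r0 = r1 * \<alpha> i\<close> survive. The two constituents then differ by
  \<open>c0 - c1\<close>, they both lie in a supporting hyperplane of \<open>K\<close> at the point, and the normal of
  this hyperplane is the radial direction of the ball, whence the orthogonality
  (\<open>inner_touching_point\<close>).

  Outer inclusion: let \<open>p i\<close> and \<open>q i\<close> be the coordinates of a point relative to the two given
  ellipsoids, in units of their semi-axes. Relative to the mean ellipsoid, the coordinate is
  \<open>A * p i + B * q i\<close>, and the two bounds on \<open>\<mu> i\<close> say exactly \<open>A \<le> 1 - l\<close> and \<open>B \<le> l\<close>. Convexity of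
  the square gives \<open>(A * p i + B * q i)\<^sup>2 \<le> (1 - l) * (p i)\<^sup>2 + l * (q i)\<^sup>2\<close>, and summation over \<open>i\<close>
  gives the inclusion (\<open>outer_ellipsoid_bound\<close>). At a common boundary point all these estimates
  are equalities. Hence \<open>p = q\<close>, and \<open>A = 1 - l\<close>, \<open>B = l\<close> wherever \<open>p i\<close> does not vanish; this is
  the equality case of the inequality between the means again, which
  forces \<open>R0 = R1 * \<alpha> i\<close>.
\<close>

section \<open>Weighted means of two numbers\<close>

text \<open>
  Divide both numbers by their arithmetic mean \<open>m\<close> and add the estimates \<open>ln x \<le> x - 1\<close> with
  weights \<open>1 - l\<close> and \<open>l\<close>. The right-hand sides cancel, and the equality hypothesis says that the
  left-hand sides cancel as well; so both estimates are equalities, which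
  happens only at \<open>x = 1\<close>.
\<close>

lemma weighted_am_gm_eq_imp_eq:
  fixes a b l :: real
  assumes "a > 0" "b > 0" "0 < l" "l < 1"
    and eq: "a powr (1 - l) * b powr l = (1 - l) * a + l * b"
  shows "a = b"
proof -
  define m where "m = (1 - l) * a + l * b"
  have m: "m > 0"
    using assms by (simp add: m_def add_pos_pos)
  have "ln m = ln (a powr (1 - l) * b powr l)"
    by (simp only: eq m_def)
  also have "\<dots> = (1 - l) * ln a + l * ln b"
    using assms(1,2) by (simp add: ln_mult)
  finally have "(1 - l) * ln (a / m) + l * ln (b / m) = 0"
    using m assms by (simp add: ln_div algebra_simps)
  moreover have "(1 - l) * (a / m - 1) + l * (b / m - 1) = 0"
    using m by (simp add: m_def field_simps)
  ultimately have "(1 - l) * (a / m - 1 - ln (a / m)) + l * (b / m - 1 - ln (b / m)) = 0"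
    by (simp add: algebra_simps)
  moreover have "a / m - 1 - ln (a / m) \<ge> 0" "b / m - 1 - ln (b / m) \<ge> 0"
    using ln_le_minus_one[of "a / m"] ln_le_minus_one[of "b / m"] m assms by auto
  ultimately have "(1 - l) * (a / m - 1 - ln (a / m)) = 0 \<and> l * (b / m - 1 - ln (b / m)) = 0"
    using assms(3,4) by (subst (asm) add_nonneg_eq_0_iff) (auto intro: mult_nonneg_nonneg)
  then have "ln (a / m) = a / m - 1" "ln (b / m) = b / m - 1"
    using assms(3,4) by auto
  then have "a / m = 1" "b / m = 1"
    using m assms(1,2) by (simp_all only: ln_eq_minus_one divide_pos_pos)
  with m show ?thesis
    by simp
qed

text \<open>
  The last term measures the defect in the convexity of the square. The absolute values matter below:
  lowering the weights \<open>1 - l\<close> and \<open>l\<close> can increase the modulus of a combination of two numbers of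
  opposite sign, but never beyond the weighted mean of their moduli.
\<close>

lemma convex_combination_abs_square:
  fixes p q l :: real
  shows "((1 - l) * \<bar>p\<bar> + l * \<bar>q\<bar>)\<^sup>2 = (1 - l) * p\<^sup>2 + l * q\<^sup>2 - l * (1 - l) * (\<bar>p\<bar> - \<bar>q\<bar>)\<^sup>2"
proof -
  have "((1 - l) * x + l * y)\<^sup>2 = (1 - l) * x\<^sup>2 + l * y\<^sup>2 - l * (1 - l) * (x - y)\<^sup>2" for x y :: real
    by (simp add: power2_eq_square algebra_simps)
  from this[of "\<bar>p\<bar>" "\<bar>q\<bar>"] show ?thesis
    by simp
qed

lemma dominated_combination_square_le_abs:
  fixes A B l p q :: real
  assumes "0 \<le> A" "A \<le> 1 - l" "0 \<le> B" "B \<le> l"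
  shows "(A * p + B * q)\<^sup>2 \<le> ((1 - l) * \<bar>p\<bar> + l * \<bar>q\<bar>)\<^sup>2"
proof -
  have "\<bar>A * p + B * q\<bar> \<le> A * \<bar>p\<bar> + B * \<bar>q\<bar>"
    using abs_triangle_ineq[of "A * p" "B * q"] assms by (simp add: abs_mult)
  also have "\<dots> \<le> (1 - l) * \<bar>p\<bar> + l * \<bar>q\<bar>"
    using assms by (intro add_mono mult_right_mono) auto
  finally show ?thesis
    by (metis abs_ge_zero power2_abs power_mono)
qed

lemma dominated_combination_square_le:
  fixes A B l p q :: real
  assumes "0 \<le> A" "A \<le> 1 - l" "0 \<le> B" "B \<le> l"
  shows "(A * p + B * q)\<^sup>2 \<le> (1 - l) * p\<^sup>2 + l * q\<^sup>2"
proof -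
  have "0 \<le> l * (1 - l) * (\<bar>p\<bar> - \<bar>q\<bar>)\<^sup>2"
    using assms by (intro mult_nonneg_nonneg) auto
  with dominated_combination_square_le_abs[OF assms, of p q] show ?thesis
    by (simp add: convex_combination_abs_square)
qed

text \<open>
  Equality makes the convexity defect vanish, so \<open>p\<close> and \<open>q\<close> agree up to sign. Opposite
  signs would require \<open>\<bar>A - B\<bar> = 1\<close>, impossible since \<open>A\<close> and \<open>B\<close> lie in \<open>[0, 1)\<close>; equal signs
  require \<open>A + B = 1\<close>, which is attained only at the upper bounds.
\<close>

lemma dominated_combination_square_eq:
  fixes A B l p q :: real
  assumes AB: "0 \<le> A" "A \<le> 1 - l" "0 \<le> B" "B \<le> l" and l: "0 < l" "l < 1"
    and eq: "(A * p + B * q)\<^sup>2 = (1 - l) * p\<^sup>2 + l * q\<^sup>2"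
  shows "p = q" and "p \<noteq> 0 \<Longrightarrow> A = 1 - l \<and> B = l"
proof -
  have "l * (1 - l) * (\<bar>p\<bar> - \<bar>q\<bar>)\<^sup>2 \<le> 0"
    using dominated_combination_square_le_abs[OF AB, of p q]
    by (simp add: convex_combination_abs_square eq)
  moreover have "l * (1 - l) > 0"
    using l by simp
  ultimately have "(\<bar>p\<bar> - \<bar>q\<bar>)\<^sup>2 \<le> 0"
    by (meson mult_pos_pos not_less)
  then have abs: "\<bar>p\<bar> = \<bar>q\<bar>"
    by simp
  then have "q\<^sup>2 = p\<^sup>2"
    by (metis power2_abs)
  with eq have square: "(A * p + B * q)\<^sup>2 = p\<^sup>2"
    by (simp add: algebra_simps)
  have *: "p = q \<and> A = 1 - l \<and> B = l" if "p \<noteq> 0"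
  proof (cases "q = p")
    case True
    with square have "((A + B) * p)\<^sup>2 = p\<^sup>2"
      by (simp add: distrib_right)
    then have "(A + B)\<^sup>2 = 1"
      using that by (simp add: power_mult_distrib)
    then have "A + B = 1"
      using AB by (simp add: power2_eq_1_iff)
    with AB True show ?thesis
      by linarith
  next
    case False
    with abs have "q = - p"
      by (auto simp: abs_if split: if_splits)
    with square have "((A - B) * p)\<^sup>2 = p\<^sup>2"
      by (simp add: left_diff_distrib)
    then have "(A - B)\<^sup>2 = 1"
      using that by (simp add: power_mult_distrib)
    then have "A - B = 1 \<or> A - B = - 1"
      by (simp add: power2_eq_1_iff)
    with AB l show ?thesis
      by linarith
  qed
  then show "p \<noteq> 0 \<Longrightarrow> A = 1 - l \<and> B = l"
    by blast
  show "p = q"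
    using * abs by (cases "p = 0") auto
qed

section \<open>Ellipsoids with given axes\<close>

text \<open>
  The squared gauge of the ellipsoid with centre \<open>z\<close> and semi-axis \<open>w i\<close> along \<open>v i\<close>. Carrying centre
  and semi-axes as parameters puts translates and dilates of mean ellipsoids into one form, whose
  values below, at and above 1 distinguish interior, boundary and exterior.
\<close>

definition ellipsoid_form ::
    "('n::finite \<Rightarrow> real ^ 'n) \<Rightarrow> ('n \<Rightarrow> real) \<Rightarrow> real ^ 'n \<Rightarrow> real ^ 'n \<Rightarrow> real" where
  "ellipsoid_form v w z x = (\<Sum>i\<in>UNIV. (((x - z) \<bullet> v i) / w i)\<^sup>2)"

lemma image_mean_ellipsoid:
  fixes v :: "'n::finite \<Rightarrow> real ^ 'n"
  assumes \<alpha>: "\<forall>i. \<alpha> i > 0" and \<rho>: "\<rho> > 0"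
  shows "(\<lambda>x. \<rho> *\<^sub>R x + z) ` mean_ellipsoid v \<alpha> l =
    {x. ellipsoid_form v (\<lambda>i. \<rho> * \<alpha> i powr l) z x \<le> 1}"
proof -
  have sq: "\<alpha> i powr (2 * l) = (\<alpha> i powr l)\<^sup>2" for i
    by (simp add: power2_eq_square flip: powr_add)
  have form: "(\<Sum>i\<in>UNIV. (y \<bullet> v i)\<^sup>2 / \<alpha> i powr (2 * l)) =
      ellipsoid_form v (\<lambda>i. \<rho> * \<alpha> i powr l) z (\<rho> *\<^sub>R y + z)" for y
    using \<rho> by (simp add: ellipsoid_form_def power_divide sq power_mult_distrib)
  have surj: "x = \<rho> *\<^sub>R ((1 / \<rho>) *\<^sub>R (x - z)) + z" for x
    using \<rho> by simp
  show ?thesis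
    unfolding mean_ellipsoid_def form
  proof (intro equalityI subsetI)
    fix x
    assume "x \<in> {x. ellipsoid_form v (\<lambda>i. \<rho> * \<alpha> i powr l) z x \<le> 1}"
    then have "(1 / \<rho>) *\<^sub>R (x - z) \<in> {y. ellipsoid_form v (\<lambda>i. \<rho> * \<alpha> i powr l) z (\<rho> *\<^sub>R y + z) \<le> 1}"
      by (simp only: surj[symmetric] mem_Collect_eq)
    then show "x \<in> (\<lambda>x. \<rho> *\<^sub>R x + z) ` {y. ellipsoid_form v (\<lambda>i. \<rho> * \<alpha> i powr l) z (\<rho> *\<^sub>R y + z) \<le> 1}"
      by (rule rev_image_eqI) (rule surj)
  qed auto
qed

lemma open_ellipsoid_form_less: "open {x. ellipsoid_form v w z x < 1}"
  unfolding ellipsoid_form_def divide_inverse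
  by (intro open_Collect_less continuous_intros)

lemma closed_ellipsoid_form_le: "closed {x. ellipsoid_form v w z x \<le> 1}"
  unfolding ellipsoid_form_def divide_inverse
  by (intro closed_Collect_le continuous_intros)

lemma ellipsoid_form_less_imp_interior:
  assumes "ellipsoid_form v w z x < 1" and "{x. ellipsoid_form v w z x \<le> 1} \<subseteq> S"
  shows "x \<in> interior S"
  using assms by (intro interiorI[OF open_ellipsoid_form_less]) auto

lemma ellipsoid_form_shift_scale:
  "ellipsoid_form v w z (z + s *\<^sub>R (x - z)) = s\<^sup>2 * ellipsoid_form v w z x"
  unfolding ellipsoid_form_def sum_distrib_left
proof (rule sum.cong)
  fix i
  have "(z + s *\<^sub>R (x - z) - z) \<bullet> v i / w i = s * ((x - z) \<bullet> v i / w i)"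
    by (simp only: add_diff_cancel_left' inner_scaleR_left times_divide_eq_right)
  then show "((z + s *\<^sub>R (x - z) - z) \<bullet> v i / w i)\<^sup>2 = s\<^sup>2 * ((x - z) \<bullet> v i / w i)\<^sup>2"
    by (simp only: power_mult_distrib)
qed (rule refl)

text \<open>
  A point where the form equals 1 is not interior, because pushing it slightly away from the centre
  multiplies the form by a factor greater than 1.
\<close>

lemma frontier_ellipsoid:
  "frontier {x. ellipsoid_form v w z x \<le> 1} = {x. ellipsoid_form v w z x = 1}" (is "frontier ?S = _")
proof -
  have "interior ?S = {x. ellipsoid_form v w z x < 1}"
  proof (intro equalityI subsetI)
    fix x assume x: "x \<in> interior ?S"
    have "((\<lambda>s::real. z + s *\<^sub>R (x - z)) \<longlongrightarrow> z + 1 *\<^sub>R (x - z)) (at_right 1)"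
      by (intro tendsto_add tendsto_scaleR tendsto_const tendsto_ident_at)
    then have "\<forall>\<^sub>F s in at_right 1. z + s *\<^sub>R (x - z) \<in> interior ?S"
      by (rule topological_tendstoD) (use x in simp_all)
    then have "\<forall>\<^sub>F s in at_right 1. z + s *\<^sub>R (x - z) \<in> interior ?S \<and> s > (1::real)"
      by (rule eventually_conj[OF _ eventually_at_right_less])
    from eventually_happens'[OF trivial_limit_at_right_real this]
    obtain s :: real where s: "z + s *\<^sub>R (x - z) \<in> interior ?S" "s > 1"
      by (elim exE conjE)
    then have "ellipsoid_form v w z (z + s *\<^sub>R (x - z)) \<le> 1"
      using interior_subset[of ?S] by blast
    then have "s\<^sup>2 * ellipsoid_form v w z x \<le> 1"
      by (simp only: ellipsoid_form_shift_scale)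
    moreover have "s\<^sup>2 > 1"
      using s(2) by (simp add: one_less_power)
    moreover have "1 \<le> ellipsoid_form v w z x \<Longrightarrow> s\<^sup>2 * 1 \<le> s\<^sup>2 * ellipsoid_form v w z x"
      by (intro mult_left_mono) auto
    ultimately have "ellipsoid_form v w z x < 1"
      by linarith
    then show "x \<in> {x. ellipsoid_form v w z x < 1}"
      by simp
  next
    fix x assume "x \<in> {x. ellipsoid_form v w z x < 1}"
    then show "x \<in> interior ?S"
      by (intro ellipsoid_form_less_imp_interior[where v = v and w = w and z = z]) auto
  qed
  then have "frontier ?S = ?S - {x. ellipsoid_form v w z x < 1}"
    by (simp only: frontier_def closure_closed[OF closed_ellipsoid_form_le])
  also have "\<dots> = {x. ellipsoid_form v w z x = 1}"
    by (simp only: set_eq_iff mem_Collect_eq Diff_iff not_less order_eq_iff[where 'a = real]) simp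
  finally show ?thesis .
qed

lemma inner_orthonormal_sum:
  assumes "orthonormal_basis v"
  shows "(\<Sum>i\<in>UNIV. f i *\<^sub>R v i) \<bullet> v j = f j"
proof -
  have "v i \<bullet> v j = (if i = j then 1 else 0)" for i
    using assms unfolding orthonormal_basis_def by blast
  then have "(\<Sum>i\<in>UNIV. f i *\<^sub>R v i) \<bullet> v j = (\<Sum>i\<in>UNIV. f i * (if i = j then 1 else 0))"
    by (simp only: inner_sum_left inner_scaleR_left)
  also have "\<dots> = (\<Sum>i\<in>UNIV. if i = j then f i else 0)"
    by (intro sum.cong) auto
  finally show ?thesis
    by simp
qed

lemma inner_orthonormal_sums:
  assumes "orthonormal_basis v"
  shows "(\<Sum>i\<in>UNIV. f i *\<^sub>R v i) \<bullet> (\<Sum>i\<in>UNIV. g i *\<^sub>R v i) = (\<Sum>i\<in>UNIV. f i * g i)"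
proof -
  have "(\<Sum>i\<in>UNIV. f i *\<^sub>R v i) \<bullet> (\<Sum>j\<in>UNIV. g j *\<^sub>R v j) =
      (\<Sum>j\<in>UNIV. g j * ((\<Sum>i\<in>UNIV. f i *\<^sub>R v i) \<bullet> v j))"
    by (simp only: inner_sum_right inner_scaleR_right)
  then show ?thesis
    by (simp only: inner_orthonormal_sum[OF assms] mult.commute)
qed

lemma orthonormal_basis_ext:
  assumes "orthonormal_basis v" and "\<And>i. x \<bullet> v i = y \<bullet> v i"
  shows "x = y"
proof -
  have "x = (\<Sum>i\<in>UNIV. (x \<bullet> v i) *\<^sub>R v i)"
    by (rule orthonormal_basis_expansion[OF assms(1), symmetric])
  also have "\<dots> = (\<Sum>i\<in>UNIV. (y \<bullet> v i) *\<^sub>R v i)"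
    by (simp only: assms(2))
  also have "\<dots> = y"
    by (rule orthonormal_basis_expansion[OF assms(1)])
  finally show ?thesis .
qed

lemma in_span_basis_subset:
  assumes "orthonormal_basis v" and "\<And>i. x \<bullet> v i \<noteq> 0 \<Longrightarrow> P i"
  shows "x \<in> span {v i |i. P i}"
proof -
  have "(\<Sum>i\<in>UNIV. (x \<bullet> v i) *\<^sub>R v i) \<in> span {v i |i. P i}"
  proof (rule span_sum)
    fix i show "(x \<bullet> v i) *\<^sub>R v i \<in> span {v i |i. P i}"
      using assms(2)[of i] by (cases "x \<bullet> v i = 0") (auto intro: span_scale span_base span_zero)
  qed
  then show ?thesis
    by (simp add: orthonormal_basis_expansion[OF assms(1)])
qed

section \<open>The inner ellipsoid\<close>

text \<open>
  The \<open>i\<close>-th coordinate of \<open>x\<close> relative to the mean centre is divided by the arithmetic mean \<open>A i\<close> of the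
  semi-axes instead of their geometric mean \<open>G i\<close>. Since \<open>G i \<le> A i\<close>, the resulting vector \<open>g\<close> stays in
  the unit ball, and since \<open>A i\<close> is affine in the two semi-axes, scaling \<open>g\<close> by each set of
  semi-axes gives the two points. If \<open>g\<close> is a unit vector, no coordinate
  lost length, so \<open>G i = A i\<close> wherever \<open>g i\<close> does not vanish.
\<close>

lemma inner_ellipsoid_decomposition:
  fixes v :: "'n::finite \<Rightarrow> real ^ 'n"
  assumes v: "orthonormal_basis v" and \<alpha>: "\<forall>i. \<alpha> i > 0" and radii: "r0 > 0" "r1 > 0"
    and l: "0 \<le> l" "l \<le> 1"
    and x: "ellipsoid_form v (\<lambda>i. r0 powr (1 - l) * r1 powr l * \<alpha> i powr l)
              ((1 - l) *\<^sub>R c0 + l *\<^sub>R c1) x \<le> 1"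
  obtains y0 y1 where
    "ellipsoid_form v (\<lambda>i. r0) c0 y0 \<le> 1"
    "ellipsoid_form v (\<lambda>i. r1 * \<alpha> i) c1 y1 \<le> 1"
    "x = (1 - l) *\<^sub>R y0 + l *\<^sub>R y1"
    "0 < l \<and> l < 1 \<and> ellipsoid_form v (\<lambda>i. r0) c0 y0 = 1 \<longrightarrow>
       y0 - c0 = y1 - c1 \<and> y0 - c0 \<in> span {v i |i. \<alpha> i = r0 / r1}"
proof -
  define G where "G i = r0 powr (1 - l) * r1 powr l * \<alpha> i powr l" for i
  define A where "A i = (1 - l) * r0 + l * (r1 * \<alpha> i)" for i
  define c where "c = (1 - l) *\<^sub>R c0 + l *\<^sub>R c1"
  define g where "g i = ((x - c) \<bullet> v i) / A i" for i
  define s where "s i = ((x - c) \<bullet> v i) / G i" for i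
  have G: "G i = r0 powr (1 - l) * (r1 * \<alpha> i) powr l" for i
    using radii \<alpha>[rule_format, of i] by (simp add: G_def powr_mult)
  have G_pos: "G i > 0" for i
    using radii \<alpha>[rule_format, of i] by (simp add: G_def)
  have G_le_A: "G i \<le> A i" for i
    unfolding G A_def using radii \<alpha>[rule_format, of i] l by (intro Youngs_inequality_0) auto
  have A_pos: "A i > 0" for i
    using G_pos[of i] G_le_A[of i] by linarith
  have le: "(g i)\<^sup>2 \<le> (s i)\<^sup>2" for i
    unfolding g_def s_def power_divide using G_pos[of i] G_le_A[of i]
    by (intro divide_left_mono power_mono) auto
  have s: "(\<Sum>i\<in>UNIV. (s i)\<^sup>2) \<le> 1"
    using x by (simp add: ellipsoid_form_def s_def c_def G_def)
  have "(\<Sum>i\<in>UNIV. (g i)\<^sup>2) \<le> (\<Sum>i\<in>UNIV. (s i)\<^sup>2)"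
    by (intro sum_mono le)
  with s have g: "(\<Sum>i\<in>UNIV. (g i)\<^sup>2) \<le> 1"
    by linarith
  have decomp: "x = (1 - l) *\<^sub>R (c0 + (\<Sum>i\<in>UNIV. (r0 * g i) *\<^sub>R v i)) +
      l *\<^sub>R (c1 + (\<Sum>i\<in>UNIV. (r1 * \<alpha> i * g i) *\<^sub>R v i))"
  proof (rule orthonormal_basis_ext[OF v])
    fix i
    have "A i * g i = x \<bullet> v i - c \<bullet> v i"
      using A_pos[of i] by (simp add: g_def inner_diff_left)
    then show "x \<bullet> v i = ((1 - l) *\<^sub>R (c0 + (\<Sum>i\<in>UNIV. (r0 * g i) *\<^sub>R v i)) +
      l *\<^sub>R (c1 + (\<Sum>i\<in>UNIV. (r1 * \<alpha> i * g i) *\<^sub>R v i))) \<bullet> v i"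
      by (simp add: inner_add_left inner_orthonormal_sum[OF v] A_def c_def algebra_simps)
  qed
  have axes: "\<forall>i. g i \<noteq> 0 \<longrightarrow> \<alpha> i = r0 / r1"
    if l': "0 < l" "l < 1" and g1: "(\<Sum>i\<in>UNIV. (g i)\<^sup>2) = 1"
  proof (intro allI impI)
    fix i assume "g i \<noteq> 0"
    have "(\<Sum>i\<in>UNIV. (g i)\<^sup>2) = (\<Sum>i\<in>UNIV. (s i)\<^sup>2)"
      using g1 s sum_mono[of UNIV "\<lambda>i. (g i)\<^sup>2" "\<lambda>i. (s i)\<^sup>2"] le by simp
    then have "(g i)\<^sup>2 = (s i)\<^sup>2"
      by (rule sum_mono_inv) (auto simp: le)
    with \<open>g i \<noteq> 0\<close> have "(A i)\<^sup>2 = (G i)\<^sup>2"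
      by (simp add: g_def s_def power_divide)
    then have "G i = A i"
      using A_pos[of i] G_pos[of i] by simp
    then have "r0 = r1 * \<alpha> i"
      unfolding G A_def
      by (rule weighted_am_gm_eq_imp_eq[OF _ _ l', rotated 2]) (use radii \<alpha> in simp_all)
    then show "\<alpha> i = r0 / r1"
      using radii by simp
  qed
  define s0 where "s0 = (\<Sum>i\<in>UNIV. (r0 * g i) *\<^sub>R v i)"
  define s1 where "s1 = (\<Sum>i\<in>UNIV. (r1 * \<alpha> i * g i) *\<^sub>R v i)"
  have form0: "ellipsoid_form v (\<lambda>i. r0) c0 (c0 + s0) = (\<Sum>i\<in>UNIV. (g i)\<^sup>2)"
    using radii by (simp add: ellipsoid_form_def s0_def inner_orthonormal_sum[OF v])
  have \<alpha>_nz: "\<alpha> i \<noteq> 0" for i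
    using \<alpha>[rule_format, of i] by simp
  have form1: "ellipsoid_form v (\<lambda>i. r1 * \<alpha> i) c1 (c1 + s1) = (\<Sum>i\<in>UNIV. (g i)\<^sup>2)"
    using radii by (simp add: ellipsoid_form_def s1_def inner_orthonormal_sum[OF v] \<alpha>_nz)
  show ?thesis
  proof
    show "ellipsoid_form v (\<lambda>i. r0) c0 (c0 + s0) \<le> 1"
      "ellipsoid_form v (\<lambda>i. r1 * \<alpha> i) c1 (c1 + s1) \<le> 1"
      using g by (simp_all add: form0 form1)
    show "x = (1 - l) *\<^sub>R (c0 + s0) + l *\<^sub>R (c1 + s1)"
      by (simp add: decomp s0_def s1_def)
    show "0 < l \<and> l < 1 \<and> ellipsoid_form v (\<lambda>i. r0) c0 (c0 + s0) = 1 \<longrightarrow>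
       c0 + s0 - c0 = c1 + s1 - c1 \<and> c0 + s0 - c0 \<in> span {v i |i. \<alpha> i = r0 / r1}"
    proof (intro impI)
      assume "0 < l \<and> l < 1 \<and> ellipsoid_form v (\<lambda>i. r0) c0 (c0 + s0) = 1"
      then have axis: "\<And>i. g i \<noteq> 0 \<Longrightarrow> \<alpha> i = r0 / r1"
        using axes form0 by simp
      have "s0 = s1"
        unfolding s0_def s1_def
      proof (rule sum.cong)
        fix i
        show "(r0 * g i) *\<^sub>R v i = (r1 * \<alpha> i * g i) *\<^sub>R v i"
          using axis[of i] radii by (cases "g i = 0") auto
      qed simp
      moreover have "s0 \<in> span {v i |i. \<alpha> i = r0 / r1}"
        using axis by (intro in_span_basis_subset[OF v]) (auto simp: s0_def inner_orthonormal_sum[OF v])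
      ultimately show "c0 + s0 - c0 = c1 + s1 - c1 \<and> c0 + s0 - c0 \<in> span {v i |i. \<alpha> i = r0 / r1}"
        by simp
    qed
  qed
qed

lemma inner_ellipsoid_subset:
  fixes v :: "'n::finite \<Rightarrow> real ^ 'n"
  assumes v: "orthonormal_basis v" and \<alpha>: "\<forall>i. \<alpha> i > 0" and radii: "r0 > 0" "r1 > 0"
    and l: "0 \<le> l" "l \<le> 1" and K: "convex K"
    and K0: "{y. ellipsoid_form v (\<lambda>i. r0) c0 y \<le> 1} \<subseteq> K"
    and K1: "{y. ellipsoid_form v (\<lambda>i. r1 * \<alpha> i) c1 y \<le> 1} \<subseteq> K"
  shows "{x. ellipsoid_form v (\<lambda>i. r0 powr (1 - l) * r1 powr l * \<alpha> i powr l)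
              ((1 - l) *\<^sub>R c0 + l *\<^sub>R c1) x \<le> 1} \<subseteq> K"
proof
  fix x
  assume "x \<in> {x. ellipsoid_form v (\<lambda>i. r0 powr (1 - l) * r1 powr l * \<alpha> i powr l)
              ((1 - l) *\<^sub>R c0 + l *\<^sub>R c1) x \<le> 1}"
  then obtain y0 y1 where
    y0: "ellipsoid_form v (\<lambda>i. r0) c0 y0 \<le> 1" and
    y1: "ellipsoid_form v (\<lambda>i. r1 * \<alpha> i) c1 y1 \<le> 1" and
    "x = (1 - l) *\<^sub>R y0 + l *\<^sub>R y1"
    using inner_ellipsoid_decomposition[OF v \<alpha> radii l] by blast
  then show "x \<in> K"
    using convexD[OF K, of y0 y1 "1 - l" l] K0 K1 l by auto
qed

lemma norm_orthonormal_sum: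
  assumes "orthonormal_basis v"
  shows "(norm (\<Sum>i\<in>UNIV. f i *\<^sub>R v i))\<^sup>2 = (\<Sum>i\<in>UNIV. (f i)\<^sup>2)"
  by (simp only: power2_norm_eq_inner inner_orthonormal_sums[OF assms] power2_eq_square[where 'a = real, symmetric])

text \<open>
  A linear functional attains its maximum over a ball only in the direction of its own gradient; this is
  the equality case of the Cauchy-Schwarz inequality.
\<close>

lemma supporting_normal_of_cball:
  fixes u x z :: "'a::real_inner"
  assumes u: "\<And>y. y \<in> cball z \<rho> \<Longrightarrow> u \<bullet> y \<le> u \<bullet> x" and x: "norm (x - z) \<le> \<rho>" and \<rho>: "\<rho> > 0"
  shows "\<rho> *\<^sub>R u = norm u *\<^sub>R (x - z)"
proof (cases "u = 0")
  case False
  have "z + (\<rho> / norm u) *\<^sub>R u \<in> cball z \<rho>"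
    using False \<rho> by (simp add: dist_norm)
  then have "norm u * \<rho> \<le> u \<bullet> (x - z)"
    using u[of "z + (\<rho> / norm u) *\<^sub>R u"] False
    by (simp add: inner_add_right inner_diff_right power2_norm_eq_inner[symmetric] power2_eq_square mult.commute)
  moreover have "u \<bullet> (x - z) \<le> norm u * norm (x - z)"
    by (rule norm_cauchy_schwarz)
  moreover have "norm u * norm (x - z) \<le> norm u * \<rho>"
    using x by (intro mult_left_mono) auto
  ultimately have "u \<bullet> (x - z) = norm u * norm (x - z)" "norm u * norm (x - z) = norm u * \<rho>"
    by linarith+
  then have "u \<bullet> (x - z) = norm u * norm (x - z)" "norm (x - z) = \<rho>"
    using False by simp_all
  then have "norm u *\<^sub>R (x - z) = norm (x - z) *\<^sub>R u" "norm (x - z) = \<rho>"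
    using norm_cauchy_schwarz_eq by blast+
  then show ?thesis
    by simp
qed simp

lemma cball_eq_ellipsoid_form:
  fixes v :: "'n::finite \<Rightarrow> real ^ 'n"
  assumes v: "orthonormal_basis v" and "\<rho> > 0"
  shows "cball z \<rho> = {x. ellipsoid_form v (\<lambda>i. \<rho>) z x \<le> 1}"
proof -
  have "ellipsoid_form v (\<lambda>i. \<rho>) z x = (norm (x - z) / \<rho>)\<^sup>2" for x
    using norm_orthonormal_sum[OF v, of "\<lambda>i. (x - z) \<bullet> v i"]
    by (simp add: ellipsoid_form_def power_divide orthonormal_basis_expansion[OF v] sum_divide_distrib)
  then show ?thesis
    using \<open>\<rho> > 0\<close> by (auto simp: dist_norm norm_minus_commute power_le_one_iff)
qed

text \<open>
  The point \<open>x\<close> is a proper convex combination of points \<open>y0\<close>, \<open>y1\<close> of the two ellipsoids. If \<open>y0\<close>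
  were interior to the ball, \<open>x\<close> would be interior to \<open>K\<close>; so the equality case of the decomposition
  applies and \<open>y0 - y1 = c0 - c1\<close>. A functional supporting \<open>K\<close> at \<open>x\<close> takes the same value
  at \<open>y0\<close> and \<open>y1\<close>, hence annihilates \<open>c0 - c1\<close>. As it also supports the ball at \<open>y0\<close>, it is
  a multiple of \<open>y0 - c0\<close>, which is the position of \<open>x\<close> relative to the mean centre.
\<close>

lemma inner_touching_point:
  fixes v :: "'n::finite \<Rightarrow> real ^ 'n"
  assumes v: "orthonormal_basis v" and \<alpha>: "\<forall>i. \<alpha> i > 0" and radii: "r0 > 0" "r1 > 0"
    and l: "0 < l" "l < 1" and K: "convex K" and x_front: "x \<in> frontier K"
    and K0: "{y. ellipsoid_form v (\<lambda>i. r0) c0 y \<le> 1} \<subseteq> K"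
    and K1: "{y. ellipsoid_form v (\<lambda>i. r1 * \<alpha> i) c1 y \<le> 1} \<subseteq> K"
    and x: "ellipsoid_form v (\<lambda>i. r0 powr (1 - l) * r1 powr l * \<alpha> i powr l)
              ((1 - l) *\<^sub>R c0 + l *\<^sub>R c1) x \<le> 1"
  shows "x - ((1 - l) *\<^sub>R c0 + l *\<^sub>R c1) \<in> span {v i |i. \<alpha> i = r0 / r1}"
    and "(x - ((1 - l) *\<^sub>R c0 + l *\<^sub>R c1)) \<bullet> (c0 - c1) = 0"
proof -
  define c where "c = (1 - l) *\<^sub>R c0 + l *\<^sub>R c1"
  obtain y0 y1 where form0: "ellipsoid_form v (\<lambda>i. r0) c0 y0 \<le> 1"
    and form1: "ellipsoid_form v (\<lambda>i. r1 * \<alpha> i) c1 y1 \<le> 1"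
    and x_eq: "x = (1 - l) *\<^sub>R y0 + l *\<^sub>R y1"
    and axes: "0 < l \<and> l < 1 \<and> ellipsoid_form v (\<lambda>i. r0) c0 y0 = 1 \<longrightarrow>
      y0 - c0 = y1 - c1 \<and> y0 - c0 \<in> span {v i |i. \<alpha> i = r0 / r1}"
    by (rule inner_ellipsoid_decomposition[OF v \<alpha> radii l[THEN less_imp_le] x])
  have K0': "y0 \<in> K" and K1': "y1 \<in> K"
    using K0 K1 form0 form1 by auto
  have "ellipsoid_form v (\<lambda>i. r0) c0 y0 = 1"
  proof (rule ccontr)
    assume "ellipsoid_form v (\<lambda>i. r0) c0 y0 \<noteq> 1"
    with form0 have "y0 \<in> interior K"
      by (intro ellipsoid_form_less_imp_interior[OF _ K0]) simp
    \<comment> \<open>Moving from a point of \<open>K\<close> a positive fraction of the way to an interior point ends in the interior.\<close>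
    then have "y1 - (1 - l) *\<^sub>R (y1 - y0) \<in> interior K"
      using l by (intro mem_interior_convex_shrink[OF K _ K1']) auto
    moreover have "y1 - (1 - l) *\<^sub>R (y1 - y0) = x"
      by (simp add: x_eq algebra_simps)
    ultimately show False
      using x_front by (simp add: frontier_def)
  qed
  with axes l have shift: "y0 - c0 = y1 - c1" and in_span: "y0 - c0 \<in> span {v i |i. \<alpha> i = r0 / r1}"
    by blast+
  have x_c: "x - c = y0 - c0"
  proof -
    have "x - c = (1 - l) *\<^sub>R (y0 - c0) + l *\<^sub>R (y1 - c1)"
      by (simp add: x_eq c_def scaleR_diff_right)
    also have "\<dots> = (1 - l + l) *\<^sub>R (y0 - c0)"
      by (simp only: shift scaleR_left_distrib)
    finally show ?thesis
      by simp
  qed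
  with in_span show "x - ((1 - l) *\<^sub>R c0 + l *\<^sub>R c1) \<in> span {v i |i. \<alpha> i = r0 / r1}"
    by (simp add: c_def)
  have x_rel: "x \<notin> rel_interior K"
  proof
    have "c0 \<in> interior K"
      by (rule ellipsoid_form_less_imp_interior[OF _ K0]) (simp add: ellipsoid_form_def)
    then have "rel_interior K = interior K"
      by (intro rel_interior_nonempty_interior) auto
    moreover assume "x \<in> rel_interior K"
    ultimately show False
      using x_front by (simp add: frontier_def)
  qed
  have x_K: "x \<in> K"
    using convexD[OF K K0' K1', of "1 - l" l] l by (simp add: x_eq)
  obtain u where "u \<noteq> 0" and u_le: "\<And>y. y \<in> K \<Longrightarrow> u \<bullet> x \<le> u \<bullet> y"
  proof (rule supporting_hyperplane_rel_boundary[OF K x_K x_rel])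
    fix u
    assume "u \<noteq> 0" "\<And>y. y \<in> K \<Longrightarrow> u \<bullet> x \<le> u \<bullet> y"
    then show ?thesis
      by (rule that)
  qed
  have "(1 - l) * (u \<bullet> y0 - u \<bullet> x) + l * (u \<bullet> y1 - u \<bullet> x) =
      (1 - l) * (u \<bullet> y0) + l * (u \<bullet> y1) - u \<bullet> x"
    by (simp add: left_diff_distrib right_diff_distrib)
  also have "\<dots> = 0"
    by (simp add: x_eq inner_add_right)
  finally have "(1 - l) * (u \<bullet> y0 - u \<bullet> x) + l * (u \<bullet> y1 - u \<bullet> x) = 0" .
  moreover have "0 \<le> (1 - l) * (u \<bullet> y0 - u \<bullet> x)" "0 \<le> l * (u \<bullet> y1 - u \<bullet> x)"
    using l u_le[OF K0'] u_le[OF K1'] by simp_all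
  ultimately have "(1 - l) * (u \<bullet> y0 - u \<bullet> x) = 0" "l * (u \<bullet> y1 - u \<bullet> x) = 0"
    by linarith+
  then have u0: "u \<bullet> y0 = u \<bullet> x" and u1: "u \<bullet> y1 = u \<bullet> x"
    using l by simp_all
  have ball: "{y. ellipsoid_form v (\<lambda>i. r0) c0 y \<le> 1} = cball c0 r0"
    using cball_eq_ellipsoid_form[OF v] radii by simp
  \<comment> \<open>The functional \<open>u\<close> is minimal on \<open>K\<close> at \<open>x\<close>, whence the sign.\<close>
  have "r0 *\<^sub>R (- u) = norm (- u) *\<^sub>R (y0 - c0)"
  proof (rule supporting_normal_of_cball)
    show "- u \<bullet> y \<le> - u \<bullet> y0" if "y \<in> cball c0 r0" for y
      using that K0 ball u_le[of y] u0 by auto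
    have "y0 \<in> cball c0 r0"
      using form0 ball by auto
    then show "norm (y0 - c0) \<le> r0"
      by (simp add: dist_norm norm_minus_commute)
  qed (rule radii)
  then have "norm u * ((y0 - c0) \<bullet> (c0 - c1)) = (r0 *\<^sub>R (- u)) \<bullet> (c0 - c1)"
    by (simp only: inner_scaleR_left norm_minus_cancel)
  moreover have "c0 - c1 = y0 - y1"
    using shift by (simp add: algebra_simps)
  then have "u \<bullet> (c0 - c1) = 0"
    using u0 u1 by (simp add: inner_diff_right)
  ultimately show "(x - ((1 - l) *\<^sub>R c0 + l *\<^sub>R c1)) \<bullet> (c0 - c1) = 0"
    using x_c \<open>u \<noteq> 0\<close> by (simp add: c_def)
qed

section \<open>The outer ellipsoid\<close>

text \<open>
  With \<open>b = R1 * a / R0\<close> the semi-axis \<open>w\<close> of the mean ellipsoid satisfies \<open>R0 / w = b powr (- l)\<close> and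
  \<open>R1 * a / w = b powr (1 - l)\<close>, so the two bounds on \<open>m\<close> are the two bounds claimed here. If both
  are attained, the weights \<open>1 - m = (1 - l) * b powr l\<close> and \<open>m = l * b powr (l - 1)\<close> add up to 1, which
  after multiplication by \<open>b powr (1 - l)\<close> reads \<open>(1 - l) * b + l = b powr (1 - l)\<close>: equality
  between the means of \<open>b\<close> and \<open>1\<close>.
\<close>

lemma outer_scaling_factors:
  fixes a R0 R1 l m :: real
  assumes pos: "a > 0" "R0 > 0" "R1 > 0"
    and lower: "1 - (1 - l) * (R1 / R0 * a) powr l \<le> m"
    and upper: "m \<le> l * (R1 / R0 * a) powr (l - 1)"
  defines "w \<equiv> R0 powr (1 - l) * R1 powr l * a powr l"
  shows "(1 - m) * (R0 / w) \<le> 1 - l" and "m * (R1 * a / w) \<le> l"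
    and "\<lbrakk>0 < l; l < 1; (1 - m) * (R0 / w) = 1 - l; m * (R1 * a / w) = l\<rbrakk> \<Longrightarrow> R0 = R1 * a"
proof -
  have w: "w = R0 powr (1 - l) * (R1 * a) powr l"
    using pos by (simp add: w_def powr_mult)
  have w_pos: "w > 0"
    using pos by (simp add: w_def)
  have b: "R1 / R0 * a = (R1 * a) / R0"
    by simp
  have f0: "(R1 / R0 * a) powr l = w / R0"
    unfolding b w using pos by (simp add: powr_divide powr_diff)
  have f1: "(R1 / R0 * a) powr (l - 1) = w / (R1 * a)"
    unfolding b w using pos by (simp add: powr_divide powr_diff field_simps)
  show "(1 - m) * (R0 / w) \<le> 1 - l"
    using lower pos w_pos unfolding f0 by (simp add: field_simps)
  show "m * (R1 * a / w) \<le> l"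
    using upper pos w_pos unfolding f1 by (simp add: field_simps)
  assume l: "0 < l" "l < 1" and eq: "(1 - m) * (R0 / w) = 1 - l" "m * (R1 * a / w) = l"
  have "(1 - m) * R0 = (1 - m) * (R0 / w) * w" "m * (R1 * a) = m * (R1 * a / w) * w"
    using w_pos by simp_all
  then have balance: "(1 - m) * R0 = (1 - l) * w" "m * (R1 * a) = l * w"
    by (simp_all only: eq)
  have split: "x = x powr (1 - l) * x powr l" if "x > 0" for x :: real
    using that by (simp flip: powr_add)
  have "w * ((1 - l) * (R1 * a) + l * R0) = ((1 - l) * w) * (R1 * a) + (l * w) * R0"
    by (simp add: algebra_simps)
  also have "\<dots> = ((1 - m) * R0) * (R1 * a) + (m * (R1 * a)) * R0"
    by (simp only: balance)
  also have "\<dots> = R0 * (R1 * a)"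
    by (simp add: algebra_simps)
  also have "\<dots> = (R0 powr (1 - l) * R0 powr l) * ((R1 * a) powr (1 - l) * (R1 * a) powr l)"
    using split[of R0] split[of "R1 * a"] pos by simp
  also have "\<dots> = w * ((R1 * a) powr (1 - l) * R0 powr l)"
    unfolding w by (simp only: mult_ac)
  finally have scaled: "w * ((1 - l) * (R1 * a) + l * R0) = w * ((R1 * a) powr (1 - l) * R0 powr l)" .
  have "w \<noteq> 0"
    using w_pos by simp
  from mult_left_cancel[OF this, THEN iffD1, OF scaled]
  have "(R1 * a) powr (1 - l) * R0 powr l = (1 - l) * (R1 * a) + l * R0" ..
  then have "R1 * a = R0"
    by (rule weighted_am_gm_eq_imp_eq[OF _ _ l, rotated 2]) (use pos in simp_all)
  then show "R0 = R1 * a" ..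
qed

text \<open>
  One coordinate of the outer inclusion: \<open>s0\<close> and \<open>s1\<close> are the offsets of a point from the two centres, and
  the left-hand side is its contribution to the form of the mean ellipsoid. If \<open>s0\<close> vanishes in the
  equality case, so does \<open>s1\<close>; otherwise the two semi-axes agree, and equal normalised offsets mean
  equal offsets.
\<close>

lemma outer_term_le:
  fixes a R0 R1 l m s0 s1 :: real
  assumes pos: "a > 0" "R0 > 0" "R1 > 0" and m: "0 \<le> m" "m \<le> 1"
    and lower: "1 - (1 - l) * (R1 / R0 * a) powr l \<le> m"
    and upper: "m \<le> l * (R1 / R0 * a) powr (l - 1)"
  defines "w \<equiv> R0 powr (1 - l) * R1 powr l * a powr l"
  shows "(((1 - m) * s0 + m * s1) / w)\<^sup>2 \<le> (1 - l) * (s0 / R0)\<^sup>2 + l * (s1 / (R1 * a))\<^sup>2"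
    and "\<lbrakk>0 < l; l < 1;
          (((1 - m) * s0 + m * s1) / w)\<^sup>2 = (1 - l) * (s0 / R0)\<^sup>2 + l * (s1 / (R1 * a))\<^sup>2\<rbrakk>
         \<Longrightarrow> s0 = s1 \<and> (s0 \<noteq> 0 \<longrightarrow> a = R0 / R1)"
proof -
  define A where "A = (1 - m) * (R0 / w)"
  define B where "B = m * (R1 * a / w)"
  note factors = outer_scaling_factors[OF pos lower upper, folded w_def A_def B_def]
  have w_pos: "w > 0"
    using pos by (simp add: w_def)
  have AB: "0 \<le> A" "A \<le> 1 - l" "0 \<le> B" "B \<le> l"
    using factors(1,2) m pos w_pos by (simp_all add: A_def B_def)
  have split: "((1 - m) * s0 + m * s1) / w = A * (s0 / R0) + B * (s1 / (R1 * a))"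
    using pos w_pos by (simp add: A_def B_def field_simps)
  show "(((1 - m) * s0 + m * s1) / w)\<^sup>2 \<le> (1 - l) * (s0 / R0)\<^sup>2 + l * (s1 / (R1 * a))\<^sup>2"
    unfolding split by (rule dominated_combination_square_le[OF AB])
  assume l: "0 < l" "l < 1"
    and "(((1 - m) * s0 + m * s1) / w)\<^sup>2 = (1 - l) * (s0 / R0)\<^sup>2 + l * (s1 / (R1 * a))\<^sup>2"
  note eq = dominated_combination_square_eq[OF AB l this(3)[unfolded split]]
  have axis: "R0 = R1 * a" if "s0 \<noteq> 0"
    using eq(2) factors(3)[OF l] that pos by simp
  moreover have "s0 = s1"
    using eq(1) axis pos by (cases "s0 = 0") auto
  ultimately show "s0 = s1 \<and> (s0 \<noteq> 0 \<longrightarrow> a = R0 / R1)"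
    using pos by auto
qed

text \<open>
  Summing the coordinate estimates bounds the form of the mean ellipsoid by the weighted mean of the two
  given forms. If this form equals 1, then both given forms equal 1 and every coordinate
  estimate is an equality; the offsets from \<open>d0\<close> and \<open>d1\<close> then coincide, so the centres do.
\<close>

lemma outer_ellipsoid_bound:
  fixes v :: "'n::finite \<Rightarrow> real ^ 'n"
  assumes v: "orthonormal_basis v"
    and \<alpha>: "\<forall>i. \<alpha> i > 0" and radii: "R0 > 0" "R1 > 0" and l: "0 \<le> l" "l \<le> 1"
    and \<mu>: "\<forall>i. 0 \<le> \<mu> i \<and> \<mu> i \<le> 1"
    and lower: "\<forall>i. 1 - (1 - l) * (R1 / R0 * \<alpha> i) powr l \<le> \<mu> i"
    and upper: "\<forall>i. \<mu> i \<le> l * (R1 / R0 * \<alpha> i) powr (l - 1)"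
    and x0: "ellipsoid_form v (\<lambda>i. R0) d0 x \<le> 1"
    and x1: "ellipsoid_form v (\<lambda>i. R1 * \<alpha> i) d1 x \<le> 1"
  defines "d \<equiv> (\<Sum>i\<in>UNIV. ((1 - \<mu> i) * (d0 \<bullet> v i) + \<mu> i * (d1 \<bullet> v i)) *\<^sub>R v i)"
    and "w \<equiv> (\<lambda>i. R0 powr (1 - l) * R1 powr l * \<alpha> i powr l)"
  shows "ellipsoid_form v w d x \<le> 1"
    and "\<lbrakk>0 < l; l < 1; ellipsoid_form v w d x = 1\<rbrakk> \<Longrightarrow>
      d0 = d1 \<and> x - d \<in> span {v i |i. \<alpha> i = R0 / R1} \<and>
      ellipsoid_form v (\<lambda>i. R0) d0 x = 1 \<and> ellipsoid_form v (\<lambda>i. R1 * \<alpha> i) d1 x = 1"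
proof -
  let ?F0 = "ellipsoid_form v (\<lambda>i. R0) d0 x" and ?F1 = "ellipsoid_form v (\<lambda>i. R1 * \<alpha> i) d1 x"
  define s0 where "s0 i = (x - d0) \<bullet> v i" for i
  define s1 where "s1 i = (x - d1) \<bullet> v i" for i
  define f where "f i = (((x - d) \<bullet> v i) / w i)\<^sup>2" for i
  define g where "g i = (1 - l) * (s0 i / R0)\<^sup>2 + l * (s1 i / (R1 * \<alpha> i))\<^sup>2" for i
  have x_d: "(x - d) \<bullet> v i = (1 - \<mu> i) * s0 i + \<mu> i * s1 i" for i
  proof -
    have "d \<bullet> v i = (1 - \<mu> i) * (d0 \<bullet> v i) + \<mu> i * (d1 \<bullet> v i)"
      unfolding d_def by (rule inner_orthonormal_sum[OF v])
    then show ?thesis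
      by (simp add: s0_def s1_def inner_diff_left algebra_simps)
  qed
  note terms = outer_term_le[OF \<alpha>[rule_format] radii conjunct1[OF \<mu>[rule_format]]
    conjunct2[OF \<mu>[rule_format]] lower[rule_format] upper[rule_format]]
  have f_le: "f i \<le> g i" for i
    unfolding f_def g_def x_d w_def by (rule terms(1))
  have sum_f: "(\<Sum>i\<in>UNIV. f i) = ellipsoid_form v w d x"
    by (simp add: f_def ellipsoid_form_def)
  have sum_g: "(\<Sum>i\<in>UNIV. g i) = (1 - l) * ?F0 + l * ?F1"
    by (simp add: g_def ellipsoid_form_def s0_def s1_def sum.distrib sum_distrib_left)
  have le0: "(1 - l) * ?F0 \<le> (1 - l) * 1" and le1: "l * ?F1 \<le> l * 1"
    using l x0 x1 by (intro mult_left_mono; simp)+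
  have sum_le: "(\<Sum>i\<in>UNIV. f i) \<le> (\<Sum>i\<in>UNIV. g i)"
    by (intro sum_mono f_le)
  have weighted_le: "(1 - l) * ?F0 + l * ?F1 \<le> 1"
    using add_mono[OF le0 le1] by simp
  show "ellipsoid_form v w d x \<le> 1"
    using order_trans[OF sum_le[unfolded sum_f sum_g] weighted_le] .
  assume l': "0 < l" "l < 1" and one: "ellipsoid_form v w d x = 1"
  have squeeze: "A = a \<and> B = b" if "A \<le> a" "B \<le> b" "a + b \<le> A + B" for A B a b :: real
    using that by linarith
  have "(1 - l) * 1 + l * 1 \<le> (1 - l) * ?F0 + l * ?F1"
    using sum_le[unfolded sum_f sum_g] one by simp
  then have "(1 - l) * ?F0 = (1 - l) * 1" "l * ?F1 = l * 1"
    using squeeze[OF le0 le1] by blast+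
  then have F: "?F0 = 1" "?F1 = 1"
    using l' by simp_all
  have "(\<Sum>i\<in>UNIV. f i) = (\<Sum>i\<in>UNIV. g i)"
    using one unfolding sum_f sum_g by (simp add: F)
  then have "f i = g i" for i
    by (rule sum_mono_inv) (auto simp: f_le)
  then have eq: "s0 i = s1 i \<and> (s0 i \<noteq> 0 \<longrightarrow> \<alpha> i = R0 / R1)" for i
    unfolding f_def g_def x_d w_def by (rule terms(2)[OF l'])
  have "d0 = d1"
  proof (rule orthonormal_basis_ext[OF v])
    fix i
    have "s0 i = s1 i"
      using eq[of i] by blast
    then show "d0 \<bullet> v i = d1 \<bullet> v i"
      by (simp add: s0_def s1_def inner_diff_left)
  qed
  moreover have "x - d \<in> span {v i |i. \<alpha> i = R0 / R1}"
  proof (rule in_span_basis_subset[OF v])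
    fix i assume "(x - d) \<bullet> v i \<noteq> 0"
    moreover have "(x - d) \<bullet> v i = s0 i"
      unfolding x_d using eq[of i] by (simp add: algebra_simps)
    ultimately show "\<alpha> i = R0 / R1"
      using eq[of i] by simp
  qed
  ultimately show "d0 = d1 \<and> x - d \<in> span {v i |i. \<alpha> i = R0 / R1} \<and> ?F0 = 1 \<and> ?F1 = 1"
    using F by blast
qed

section \<open>The mean ellipsoid of two inscribed or circumscribed ellipsoids\<close>

theorem theorem4p4:
  fixes v :: "'n::finite \<Rightarrow> real ^ 'n"
    and c0 c1 d0 d1 :: "real ^ 'n"
    and \<alpha> \<mu> :: "'n \<Rightarrow> real"
    and r0 r1 R0 R1 l :: real
    and K L :: "(real ^ 'n) set"
  defines "E \<equiv> mean_ellipsoid v \<alpha>"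
    and "c \<equiv> (1 - l) *\<^sub>R c0 + l *\<^sub>R c1"
    and "d \<equiv> (\<Sum>i\<in>UNIV. ((1 - \<mu> i) * (d0 \<bullet> v i) + \<mu> i * (d1 \<bullet> v i)) *\<^sub>R v i)"
    and "r \<equiv> r0 powr (1 - l) * r1 powr l"
    and "R \<equiv> R0 powr (1 - l) * R1 powr l"
  assumes v: "orthonormal_basis v"
    and \<alpha>: "\<forall>i. \<alpha> i > 0"
    and radii: "r0 > 0" "r1 > 0" "R0 > 0" "R1 > 0"
    and l: "0 \<le> l" "l \<le> 1"
    and \<mu>: "\<forall>i. 0 \<le> \<mu> i \<and> \<mu> i \<le> 1"
    and \<mu>_lower: "\<forall>i. 1 - (1 - l) * (R1 / R0 * \<alpha> i) powr l \<le> \<mu> i"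
    and \<mu>_upper: "\<forall>i. \<mu> i \<le> l * (R1 / R0 * \<alpha> i) powr (l - 1)"
    and K: "convex_body K"
    and L: "convex_body L"
    and K_sup: "(\<lambda>x. r0 *\<^sub>R x + c0) ` E 0 \<union> (\<lambda>x. r1 *\<^sub>R x + c1) ` E 1 \<subseteq> K"
    and L_sub: "L \<subseteq> (\<lambda>x. R0 *\<^sub>R x + d0) ` E 0 \<inter> (\<lambda>x. R1 *\<^sub>R x + d1) ` E 1"
  shows "(\<lambda>x. r *\<^sub>R x + c) ` E l \<subseteq> K
    \<and> L \<subseteq> (\<lambda>x. R *\<^sub>R x + d) ` E l
    \<and> (0 < l \<and> l < 1 \<longrightarrow>
         (\<forall>p \<in> frontier ((\<lambda>x. r *\<^sub>R x + c) ` E l) \<inter> frontier K.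
            p \<in> (\<lambda>x. x + c) ` (span {v i |i. \<alpha> i = r0 / r1} \<inter> orthogonal_comp (span {c0 - c1})))
       \<and> (\<forall>p \<in> frontier ((\<lambda>x. R *\<^sub>R x + d) ` E l) \<inter> frontier L.
            p \<in> (\<lambda>x. x + d) ` span {v i |i. \<alpha> i = R0 / R1}
          \<and> p \<in> frontier ((\<lambda>x. R0 *\<^sub>R x + d0) ` E 0)
          \<and> p \<in> frontier ((\<lambda>x. R1 *\<^sub>R x + d1) ` E 1))
       \<and> (frontier ((\<lambda>x. R *\<^sub>R x + d) ` E l) \<inter> frontier L \<noteq> {} \<longrightarrow> d0 = d1))"
proof -
  have r: "r > 0" and R: "R > 0"
    using radii by (simp_all add: r_def R_def)
  note image = image_mean_ellipsoid[where v = v, OF \<alpha>, folded E_def]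
  have image0: "(\<lambda>x. \<rho> *\<^sub>R x + z) ` E 0 = {x. ellipsoid_form v (\<lambda>i. \<rho>) z x \<le> 1}"
    and image1: "(\<lambda>x. \<rho> *\<^sub>R x + z) ` E 1 = {x. ellipsoid_form v (\<lambda>i. \<rho> * \<alpha> i) z x \<le> 1}"
    if "\<rho> > 0" for \<rho> z
  proof -
    have "\<alpha> i powr 0 = 1" "\<alpha> i powr 1 = \<alpha> i" for i
      using \<alpha>[rule_format, of i] by simp_all
    then show "(\<lambda>x. \<rho> *\<^sub>R x + z) ` E 0 = {x. ellipsoid_form v (\<lambda>i. \<rho>) z x \<le> 1}"
      and "(\<lambda>x. \<rho> *\<^sub>R x + z) ` E 1 = {x. ellipsoid_form v (\<lambda>i. \<rho> * \<alpha> i) z x \<le> 1}"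
      using image[OF that, of z 0] image[OF that, of z 1] by (simp_all only: mult_1_right)
  qed
  have K0: "{y. ellipsoid_form v (\<lambda>i. r0) c0 y \<le> 1} \<subseteq> K"
    and K1: "{y. ellipsoid_form v (\<lambda>i. r1 * \<alpha> i) c1 y \<le> 1} \<subseteq> K"
    using K_sup radii by (simp_all add: image0 image1)
  have L0: "ellipsoid_form v (\<lambda>i. R0) d0 x \<le> 1"
    and L1: "ellipsoid_form v (\<lambda>i. R1 * \<alpha> i) d1 x \<le> 1" if "x \<in> L" for x
    using subsetD[OF L_sub that] by (simp_all only: Int_iff mem_Collect_eq image0[OF radii(3)] image1[OF radii(4)])
  have "convex K" "closed L"
    using K L by (simp_all add: convex_body_def compact_imp_closed)
  have inner_sub: "(\<lambda>x. r *\<^sub>R x + c) ` E l \<subseteq> K"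
  proof
    fix x assume "x \<in> (\<lambda>x. r *\<^sub>R x + c) ` E l"
    then have "ellipsoid_form v (\<lambda>i. r0 powr (1 - l) * r1 powr l * \<alpha> i powr l)
        ((1 - l) *\<^sub>R c0 + l *\<^sub>R c1) x \<le> 1"
      unfolding image[OF r] mem_Collect_eq unfolding r_def c_def .
    then show "x \<in> K"
      using inner_ellipsoid_subset[OF v \<alpha> radii(1,2) l \<open>convex K\<close> K0 K1] by blast
  qed
  note outer = outer_ellipsoid_bound[OF v \<alpha> radii(3,4) l \<mu> \<mu>_lower \<mu>_upper L0 L1,
    folded R_def d_def]
  have outer_sub: "L \<subseteq> (\<lambda>x. R *\<^sub>R x + d) ` E l"
    unfolding image[OF R] using outer(1) by (intro subsetI CollectI)
  have inner_touch: "p \<in> (\<lambda>x. x + c) ` (span {v i |i. \<alpha> i = r0 / r1} \<inter> orthogonal_comp (span {c0 - c1}))"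
    if l': "0 < l" "l < 1" and p: "p \<in> frontier ((\<lambda>x. r *\<^sub>R x + c) ` E l) \<inter> frontier K" for p
  proof -
    have form: "ellipsoid_form v (\<lambda>i. r0 powr (1 - l) * r1 powr l * \<alpha> i powr l)
        ((1 - l) *\<^sub>R c0 + l *\<^sub>R c1) p \<le> 1"
      using p unfolding image[OF r] frontier_ellipsoid Int_iff mem_Collect_eq
      unfolding r_def c_def by (blast intro: eq_refl)
    have "p \<in> frontier K"
      using p by (rule IntD2)
    note touch = inner_touching_point[OF v \<alpha> radii(1,2) l' \<open>convex K\<close> this K0 K1 form, folded c_def]
    have "p - c \<in> orthogonal_comp (span {c0 - c1})"
      unfolding orthogonal_comp_def mem_Collect_eq
    proof
      fix y assume "y \<in> span {c0 - c1}"
      then obtain k where "y = k *\<^sub>R (c0 - c1)"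
        unfolding span_singleton by (rule rangeE)
      moreover have "(c0 - c1) \<bullet> (p - c) = 0"
        using touch(2) by (subst inner_commute)
      ultimately show "orthogonal y (p - c)"
        by (simp only: orthogonal_def inner_scaleR_left mult_zero_right)
    qed
    with touch(1) have "p - c \<in> span {v i |i. \<alpha> i = r0 / r1} \<inter> orthogonal_comp (span {c0 - c1})"
      by (rule IntI)
    then show ?thesis
      by (rule rev_image_eqI) simp
  qed
  have outer_touch: "d0 = d1 \<and> p \<in> (\<lambda>x. x + d) ` span {v i |i. \<alpha> i = R0 / R1}
      \<and> p \<in> frontier ((\<lambda>x. R0 *\<^sub>R x + d0) ` E 0) \<and> p \<in> frontier ((\<lambda>x. R1 *\<^sub>R x + d1) ` E 1)"
    if l': "0 < l" "l < 1" and p: "p \<in> frontier ((\<lambda>x. R *\<^sub>R x + d) ` E l) \<inter> frontier L" for p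
  proof -
    have "p \<in> L"
      using p frontier_subset_closed[OF \<open>closed L\<close>] by blast
    have "ellipsoid_form v (\<lambda>i. R * \<alpha> i powr l) d p = 1"
      using p unfolding image[OF R] frontier_ellipsoid Int_iff mem_Collect_eq by (rule conjunct1)
    then have "d0 = d1 \<and> p - d \<in> span {v i |i. \<alpha> i = R0 / R1} \<and>
        ellipsoid_form v (\<lambda>i. R0) d0 p = 1 \<and> ellipsoid_form v (\<lambda>i. R1 * \<alpha> i) d1 p = 1"
      by (rule outer(2)[OF \<open>p \<in> L\<close> \<open>p \<in> L\<close> l'])
    moreover from this have "p \<in> (\<lambda>x. x + d) ` span {v i |i. \<alpha> i = R0 / R1}"
      by (intro rev_image_eqI[of "p - d"]) simp_all
    ultimately show ?thesis
      unfolding image0[OF radii(3)] image1[OF radii(4)] frontier_ellipsoid mem_Collect_eq by blast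
  qed
  show ?thesis
  proof (intro conjI impI ballI inner_sub outer_sub)
    assume "0 < l \<and> l < 1"
    then have l': "0 < l" "l < 1"
      by simp_all
    note outer_touch = outer_touch[OF l']
    show "p \<in> (\<lambda>x. x + c) ` (span {v i |i. \<alpha> i = r0 / r1} \<inter> orthogonal_comp (span {c0 - c1}))"
      if "p \<in> frontier ((\<lambda>x. r *\<^sub>R x + c) ` E l) \<inter> frontier K" for p
      by (rule inner_touch[OF l' that])
    show "p \<in> (\<lambda>x. x + d) ` span {v i |i. \<alpha> i = R0 / R1}"
      "p \<in> frontier ((\<lambda>x. R0 *\<^sub>R x + d0) ` E 0)" "p \<in> frontier ((\<lambda>x. R1 *\<^sub>R x + d1) ` E 1)"
      if "p \<in> frontier ((\<lambda>x. R *\<^sub>R x + d) ` E l) \<inter> frontier L" for p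
      using outer_touch[OF that] by blast+
    assume "frontier ((\<lambda>x. R *\<^sub>R x + d) ` E l) \<inter> frontier L \<noteq> {}"
    then obtain p where "p \<in> frontier ((\<lambda>x. R *\<^sub>R x + d) ` E l) \<inter> frontier L"
      by (elim ex_in_conv[THEN iffD2, THEN exE])
    then show "d0 = d1"
      by (rule outer_touch[THEN conjunct1])
  qed
qed

end
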